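(* Let $d=1$, $\lambda\ge 0$, $\alpha\in[1,2)$, let $N_1\ge 2$ be an integer, $h=2/N_1$, $N=N_1-1$, and let $L=N_\rho h$ with $N_\rho$ a positive integer. Let the window function $w$ (see context) satisfy $0\le w(\rho)\le 1$ and $w'(\rho)<0$ for $0<\rho<L$. Let $f\in l^\infty(\Omega_h)$. Then the numerical solution $U_h=\{u_j^h\}_{x_j\in\Omega_h}$ of the WIRFD discrete problem $$(-\Delta_h)_\lambda^{\frac{\alpha}{2}}u_j^h=f(x_j),\ x_j\in\Omega_h,\qquad u_j^h=0,\ x_j\in h\mathbb{Z}\setminus\Omega_h,$$ satisfies $$\|U_h\|_{l^2(\Omega_h)}\le\frac{1}{c_0}\|f\|_{l^2(\Omega_h)},\qquad \|U_h\|_{l^\infty(\Omega_h)}\le\frac{1}{c_0}\|f\|_{l^\infty(\Omega_h)},$$ where $c_0=\dfrac{2C_{1,\alpha}(1-2^{-\alpha})}{\alpha e^{2\lambda L_\Omega}L_\Omega^{\alpha}}>0$ and $L_\Omega=(N+1)h$.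
   Context: Constant: $C_{1,\alpha}=\dfrac{\alpha\,\Gamma(\frac{1+\alpha}{2})}{2^{1-\alpha}\pi^{1/2}\Gamma(1-\frac{\alpha}{2})}$ if $\lambda=0$ or $\alpha=1$, and $C_{1,\alpha}=\dfrac{\Gamma(\frac12)}{2\pi^{1/2}|\Gamma(-\alpha)|}$ if $\lambda>0$ and $\alpha\ne1$. Window function: $w\in C^\gamma([0,\infty))$ for some $\gamma\in\mathbb{N}_0=\{0,1,2,\ldots\}$, real-valued, with $w(\rho)=1+O(\rho^\gamma)$ as $\rho\to0$ and $w(\rho)=0$ for $\rho\ge L$. Grid: $\Omega=(-1,1)$, $\Omega_h=\{x_j=-1+jh:1\le j\le N_1-1\}$, which has $N=N_1-1$ nodes. In one dimension $h\mathbb{Z}\setminus\Omega_h$ refers to all the other lattice points $x_j=-1+jh$, $j\in\mathbb{Z}$, $j\notin\{1,\dots,N\}$. Let $y_j=jh$ for $j\in\mathbb{Z}$. WIRFD operator ($d=1$): for a function $u$ on the lattice and $x\in\Omega_h$, $$(-\Delta_h)_{\lambda}^{\frac{\alpha}{2}}u(x)=C_{1,\alpha}h\left((S_{1,h}-S_1)\Delta_hu(x)+S_2u(x)-\sum_{j\neq0}\frac{u(x+y_j)}{e^{\lambda|y_j|}|y_j|^{1+\alpha}}\right),$$ where $$S_{1,h}=\frac12\sum_{j\ne0}\frac{w(|y_j|)}{e^{\lambda|y_j|}|y_j|^{\alpha-1}},\quad S_1=\frac{1}{2h}\int_{-L}^{L}\frac{w(|y|)}{e^{\lambda|y|}|y|^{\alpha-1}}dy,\quad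 S_2=\sum_{j\ne0}\frac{1}{e^{\lambda|y_j|}|y_j|^{1+\alpha}},$$ (sums over $j\in\mathbb{Z}\setminus\{0\}$) and $\Delta_hu(x)=h^{-2}[u(x-h)-2u(x)+u(x+h)]$. Norms: $\|U\|_{l^2(\Omega_h)}=\left(h\sum_{x_j\in\Omega_h}|u_j|^2\right)^{1/2}$, $\|U\|_{l^\infty(\Omega_h)}=\max_{x_j\in\Omega_h}|u_j|$ for $U=\{u_j\}_{x_j\in\Omega_h}$. *)

theory Defs
  imports "HOL-Analysis.Analysis" "HOL-Library.Landau_Symbols"
begin

definition C_const :: "real \<Rightarrow> real \<Rightarrow> real" where
  "C_const lam \<alpha> =
     (if lam = 0 \<or> \<alpha> = 1
      then \<alpha> * Gamma ((1 + \<alpha>) / 2) / (2 powr (1 - \<alpha>) * sqrt pi * Gamma (1 - \<alpha> / 2))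
      else Gamma (1 / 2) / (2 * sqrt pi * \<bar>Gamma (- \<alpha>)\<bar>))"

(* Derivatives are taken within S, hence one-sided at the end point 0 of [0, \<infinity>). *)
definition C_k_on :: "nat \<Rightarrow> (real \<Rightarrow> real) \<Rightarrow> real set \<Rightarrow> bool" where
  "C_k_on k f S \<longleftrightarrow>
     (\<exists>D :: nat \<Rightarrow> real \<Rightarrow> real.
        D 0 = f \<and>
        (\<forall>i<k. \<forall>x\<in>S. (D i has_real_derivative D (Suc i) x) (at x within S)) \<and>
        (\<forall>i\<le>k. continuous_on S (D i)))"

(* Only the values of w on [0, \<infinity>) matter, here and in the operator below. *)
definition window_function :: "nat \<Rightarrow> real \<Rightarrow> (real \<Rightarrow> real) \<Rightarrow> bool" where
  "window_function \<gamma> L w \<longleftrightarrow>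
     C_k_on \<gamma> w {0..} \<and>
     (\<lambda>\<rho>. w \<rho> - 1) \<in> O[at_right 0](\<lambda>\<rho>. \<rho> ^ \<gamma>) \<and>
     (\<forall>\<rho>\<ge>L. w \<rho> = 0)"

definition node :: "real \<Rightarrow> int \<Rightarrow> real" where
  "node h j = - 1 + of_int j * h"

definition lattice :: "real \<Rightarrow> real set" where
  "lattice h = range (node h)"

definition grid :: "nat \<Rightarrow> real \<Rightarrow> real set" where
  "grid N h = node h ` {1..int N}"

definition S1h :: "real \<Rightarrow> real \<Rightarrow> (real \<Rightarrow> real) \<Rightarrow> real \<Rightarrow> real" where
  "S1h lam \<alpha> w h =
     1 / 2 * (\<Sum>\<^sub>\<infinity>j\<in>UNIV - {0::int}.
       w \<bar>of_int j * h\<bar> / (exp (lam * \<bar>of_int j * h\<bar>) * \<bar>of_int j * h\<bar> powr (\<alpha> - 1)))"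

definition S1 :: "real \<Rightarrow> real \<Rightarrow> (real \<Rightarrow> real) \<Rightarrow> real \<Rightarrow> real \<Rightarrow> real" where
  "S1 lam \<alpha> w L h =
     1 / (2 * h) * integral {- L..L} (\<lambda>y. w \<bar>y\<bar> / (exp (lam * \<bar>y\<bar>) * \<bar>y\<bar> powr (\<alpha> - 1)))"

definition S2 :: "real \<Rightarrow> real \<Rightarrow> real \<Rightarrow> real" where
  "S2 lam \<alpha> h =
     (\<Sum>\<^sub>\<infinity>j\<in>UNIV - {0::int}.
       1 / (exp (lam * \<bar>of_int j * h\<bar>) * \<bar>of_int j * h\<bar> powr (1 + \<alpha>)))"

(* A function on the lattice is a function on the reals that is evaluated at lattice points only. *)
definition discrete_laplacian :: "real \<Rightarrow> (real \<Rightarrow> 'a::real_normed_vector) \<Rightarrow> real \<Rightarrow> 'a" where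
  "discrete_laplacian h u x = (1 / h\<^sup>2) *\<^sub>R (u (x - h) - 2 *\<^sub>R u x + u (x + h))"

definition WIRFD ::
  "real \<Rightarrow> real \<Rightarrow> (real \<Rightarrow> real) \<Rightarrow> real \<Rightarrow> real \<Rightarrow> (real \<Rightarrow> 'a::real_normed_vector) \<Rightarrow> real \<Rightarrow> 'a" where
  "WIRFD lam \<alpha> w L h u x =
     (C_const lam \<alpha> * h) *\<^sub>R
       ((S1h lam \<alpha> w h - S1 lam \<alpha> w L h) *\<^sub>R discrete_laplacian h u x
        + S2 lam \<alpha> h *\<^sub>R u x
        - (\<Sum>\<^sub>\<infinity>j\<in>UNIV - {0::int}.
            (1 / (exp (lam * \<bar>of_int j * h\<bar>) * \<bar>of_int j * h\<bar> powr (1 + \<alpha>)))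
              *\<^sub>R u (x + of_int j * h)))"

definition l2_norm :: "nat \<Rightarrow> real \<Rightarrow> (real \<Rightarrow> 'a::real_normed_vector) \<Rightarrow> real" where
  "l2_norm N h u = sqrt (h * (\<Sum>x\<in>grid N h. (norm (u x))\<^sup>2))"

definition linf_norm :: "nat \<Rightarrow> real \<Rightarrow> (real \<Rightarrow> 'a::real_normed_vector) \<Rightarrow> real" where
  "linf_norm N h u = Max ((\<lambda>x. norm (u x)) ` grid N h)"

end

theory Submission imports Defs begin

text \<open>
  The scheme is a symmetric linear system with constant diagonal whose rows on the full lattice sum
  to 0. Since \<open>\<alpha> \<ge> 1\<close>, the function \<open>w y / (exp (lam * y) * y powr (\<alpha> - 1))\<close> is decreasing, so
  \<open>h * S1h\<close>, a right Riemann sum of it, is at most \<open>h * S1\<close>; hence all off-diagonal entries are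
  nonpositive. Restricting to the grid therefore makes the matrix strictly diagonally dominant, with
  an excess of at least the kernel mass falling outside the grid. Every row misses the shifts
  \<open>N + 1 \<le> \<bar>m\<bar> \<le> 2 * N + 1\<close>, whose mass is bounded below by \<open>c\<^sub>0\<close> on comparing with
  \<open>\<integral> exp (- lam * y) * y powr (- 1 - \<alpha>)\<close> over \<open>[L\<^sub>\<Omega>, 2 * L\<^sub>\<Omega>]\<close>. Dominance gives the maximum-norm
  bound at a node where \<open>U\<close> is largest, and by symmetry the energy estimate for the \<open>l2\<close> bound.
\<close>

section \<open>Positivity of the constant and two calculus estimates\<close>

lemma C_const_pos:
  assumes "1 \<le> \<alpha>" "\<alpha> < 2"
  shows "C_const lam \<alpha> > 0"
proof (cases "lam = 0 \<or> \<alpha> = 1")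
  case True
  have "Gamma ((1 + \<alpha>) / 2) > 0" "Gamma (1 - \<alpha> / 2) > 0"
    using assms by (auto intro!: Gamma_real_pos)
  then show ?thesis using True assms by (simp add: C_const_def)
next
  case False
  \<comment> \<open>Gamma has the default value 0 at its poles. With \<alpha> = 1 excluded,
    -\<alpha> lies strictly between -2 and -1, so it is no pole.\<close>
  have "- \<alpha> \<notin> \<int>\<^sub>\<le>\<^sub>0"
  proof
    assume "- \<alpha> \<in> \<int>\<^sub>\<le>\<^sub>0"
    then obtain n :: int where "- \<alpha> = of_int n"
      by (auto elim: nonpos_Ints_cases)
    then have "of_int (- 2) < (of_int n :: real)" "of_int n < (of_int (- 1) :: real)"
      using assms False by auto
    then show False unfolding of_int_less_iff by linarith
  qed
  then have "Gamma (- \<alpha>) \<noteq> 0" by (simp add: Gamma_eq_zero_iff)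
  then show ?thesis using False by (simp add: C_const_def Gamma_one_half_real)
qed

text \<open>On each cell a decreasing function is at least its value at the right end. Antitonicity
  is asked at positive points only, since the function to which this is applied has the default
  value 0 at 0 and may blow up nearby.\<close>

lemma sum_le_integral_antimono:
  fixes g :: "real \<Rightarrow> real"
  assumes "h > 0"
    and anti: "\<And>x y. 0 < x \<Longrightarrow> x \<le> y \<Longrightarrow> y \<le> real n * h \<Longrightarrow> g y \<le> g x"
    and int: "g integrable_on {0..real n * h}"
  shows "h * (\<Sum>j=1..n. g (real j * h)) \<le> integral {0..real n * h} g"
  using anti int
proof (induction n)
  case 0
  then show ?case by simp
next
  case (Suc n)
  let ?a = "real n * h" and ?b = "real (Suc n) * h"
  have ab: "?a \<le> ?b" "0 \<le> ?a" using \<open>h > 0\<close> by (auto simp: algebra_simps)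
  have ia: "g integrable_on {0..?a}" and ib: "g integrable_on {?a..?b}"
    using ab by (auto intro!: integrable_subinterval_real[OF Suc.prems(2)] simp del: of_nat_Suc)
  have "h * (\<Sum>j=1..n. g (real j * h)) \<le> integral {0..?a} g"
    using Suc.prems(1) ab ia by (intro Suc.IH) auto
  moreover have "h * g ?b \<le> integral {?a..?b} g"
  proof -
    have "h * g ?b = integral {?a..?b} (\<lambda>_. g ?b)"
      using \<open>h > 0\<close> by (simp add: algebra_simps)
    \<comment> \<open>The first cell starts at 0, where antitonicity says nothing. Removing the end
      points leaves the integral unchanged.\<close>
    also have "\<dots> = integral {?a<..<?b} (\<lambda>_. g ?b)"
      by (rule integral_open_interval_real)
    also have "\<dots> \<le> integral {?a<..<?b} g"
      using ib ab
      by (intro integral_le Suc.prems(1)) (auto simp: integrable_on_open_interval_real)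
    also have "\<dots> = integral {?a..?b} g" by (rule integral_open_interval_real[symmetric])
    finally show ?thesis .
  qed
  ultimately show ?case
    using Henstock_Kurzweil_Integration.integral_combine[OF ab(2,1) Suc.prems(2)]
    by (simp add: distrib_left)
qed

text \<open>The left side is the integral of \<open>t powr (- p - 1)\<close> over
  \<open>{x..y}\<close>, and the integrand is largest at \<open>x\<close>. Over consecutive cells
  these left sides telescope.\<close>

lemma powr_tangent_bound:
  fixes x y p :: real
  assumes "0 < x" "x \<le> y" "0 < p"
  shows "(x powr (- p) - y powr (- p)) / p \<le> (y - x) * x powr (- p - 1)"
proof (cases "x = y")
  case False
  then have "x < y" using assms by simp
  have d: "((\<lambda>t. t powr (- p)) has_real_derivative - p * t powr (- p - 1)) (at t)"
    if "x \<le> t" for t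
    using that assms by (auto intro!: derivative_eq_intros)
  obtain z where z: "x < z" "z < y"
    "y powr (- p) - x powr (- p) = (y - x) * (- p * z powr (- p - 1))"
    using MVT2[OF \<open>x < y\<close>, of "\<lambda>t. t powr (- p)" "\<lambda>t. - p * t powr (- p - 1)"] d by auto
  have "z powr (- p - 1) \<le> x powr (- p - 1)"
    using z assms by (intro powr_mono2') auto
  then have "(y - x) * z powr (- p - 1) \<le> (y - x) * x powr (- p - 1)"
    using assms by (intro mult_left_mono) auto
  moreover have "(x powr (- p) - y powr (- p)) / p = (y - x) * z powr (- p - 1)"
    using z(3) assms by (simp add: field_simps)
  ultimately show ?thesis by simp
qed (use assms in simp)

section \<open>The lattice kernel, its summability and its tail\<close>

definition kernel :: "real \<Rightarrow> real \<Rightarrow> real \<Rightarrow> int \<Rightarrow> real" where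
  "kernel lam \<alpha> h j = 1 / (exp (lam * \<bar>of_int j * h\<bar>) * \<bar>of_int j * h\<bar> powr (1 + \<alpha>))"

lemma kernel_nonneg: "kernel lam \<alpha> h j \<ge> 0"
  by (simp add: kernel_def)

lemma kernel_minus [simp]: "kernel lam \<alpha> h (- j) = kernel lam \<alpha> h j"
  by (simp add: kernel_def)

text \<open>The exponential is at least 1, which leaves the series of n to the power -(1 +
  \<alpha>). Without summability \<open>S2\<close> would be the default value 0 and could not bound
  finite kernel sums from above.\<close>

lemma kernel_summable:
  assumes "lam \<ge> 0" "\<alpha> > 0" "h > 0"
  shows "kernel lam \<alpha> h summable_on UNIV - {0}"
proof -
  have le: "kernel lam \<alpha> h (int n) \<le> h powr (- (1 + \<alpha>)) * real n powr (- (1 + \<alpha>))" for n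
  proof (cases "n = 0")
    case False
    have "kernel lam \<alpha> h (int n) \<le> 1 / (real n * h) powr (1 + \<alpha>)"
      unfolding kernel_def using assms False
      by (intro divide_left_mono) (auto simp: mult_le_cancel_right1)
    also have "\<dots> = h powr (- (1 + \<alpha>)) * real n powr (- (1 + \<alpha>))"
      by (simp only: powr_mult powr_minus_divide) simp
    finally show ?thesis .
  qed (simp add: kernel_def)
  have "summable (\<lambda>n. h powr (- (1 + \<alpha>)) * real n powr (- (1 + \<alpha>)))"
    using assms by (intro summable_mult) (simp add: summable_real_powr_iff)
  then have "summable (\<lambda>n. kernel lam \<alpha> h (int n))"
    by (rule summable_comparison_test[rotated]) (use le kernel_nonneg in auto)
  then have s: "(\<lambda>n. kernel lam \<alpha> h (int n)) summable_on UNIV"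
    by (intro summable_nonneg_imp_summable_on kernel_nonneg)
  have p: "kernel lam \<alpha> h summable_on range int"
    using s by (subst summable_on_reindex) (auto simp: o_def)
  have "kernel lam \<alpha> h summable_on range (\<lambda>n. - int n)"
    using s by (subst summable_on_reindex) (auto simp: o_def inj_def)
  with p have "kernel lam \<alpha> h summable_on (range int \<union> range (\<lambda>n. - int n))"
    by (intro summable_on_union)
  then show ?thesis
    by (rule summable_on_subset) (auto, metis int_cases2 rangeI)
qed

text \<open>All points \<open>real m * h\<close> lie in [R, 2R], so the exponential factor is at
  least \<open>exp (- 2 * lam * R)\<close>. The remaining powers dominate the increments of
  \<open>- (y powr (- \<alpha>)) / \<alpha>\<close>, which telescope between R and 2R and leave the
  factor \<open>1 - 2 powr (- \<alpha>)\<close>.\<close>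

lemma sum_kernel_tail_ge:
  fixes n :: nat
  assumes "lam \<ge> 0" "\<alpha> > 0" "h > 0" "n > 0"
  defines "R \<equiv> real n * h"
  shows "(1 - 2 powr (- \<alpha>)) / (\<alpha> * exp (2 * lam * R) * R powr \<alpha>)
    \<le> h * (\<Sum>m=n..<2 * n. kernel lam \<alpha> h (int m))"
proof -
  have "R > 0" using assms by (simp add: R_def)
  let ?F = "\<lambda>m. - ((real m * h) powr (- \<alpha>))"
  have t: "exp (- 2 * lam * R) / \<alpha> * (?F (Suc m) - ?F m) \<le> h * kernel lam \<alpha> h (int m)"
    if "m \<in> {n..<2 * n}" for m
  proof -
    have m: "m > 0" "real m * h \<le> 2 * R" using that assms by (auto simp: R_def)
    have "(?F (Suc m) - ?F m) / \<alpha> \<le> h * (real m * h) powr (- \<alpha> - 1)"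
      using powr_tangent_bound[of "real m * h" "real (Suc m) * h" \<alpha>] m assms
      by (simp add: algebra_simps)
    moreover have "exp (- 2 * lam * R) \<le> exp (- (lam * (real m * h)))"
      using mult_left_mono[OF m(2) \<open>lam \<ge> 0\<close>] by simp
    ultimately have "exp (- 2 * lam * R) * ((?F (Suc m) - ?F m) / \<alpha>)
        \<le> exp (- (lam * (real m * h))) * (h * (real m * h) powr (- \<alpha> - 1))"
      using assms m by (intro mult_mono) (auto intro!: divide_nonneg_pos powr_mono2')
    also have "\<dots> = h * kernel lam \<alpha> h (int m)"
      using assms m
      by (simp add: kernel_def exp_minus powr_minus powr_diff powr_add field_simps)
    finally show ?thesis by simp
  qed
  have "(1 - 2 powr (- \<alpha>)) / (\<alpha> * exp (2 * lam * R) * R powr \<alpha>)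
      = exp (- 2 * lam * R) / \<alpha> * (?F (2 * n) - ?F n)"
  proof -
    have "real (2 * n) * h = 2 * R" by (simp add: R_def)
    then have "?F (2 * n) - ?F n = (1 - 2 powr (- \<alpha>)) * R powr (- \<alpha>)"
      unfolding R_def[symmetric] by (simp only:) (simp add: powr_mult algebra_simps)
    then show ?thesis by (simp add: exp_minus powr_minus divide_simps)
  qed
  also have "?F (2 * n) - ?F n = (\<Sum>m=n..<2 * n. ?F (Suc m) - ?F m)"
    by (rule sum_Suc_diff'[symmetric]) simp
  also have "exp (- 2 * lam * R) / \<alpha> * \<dots> \<le> (\<Sum>m=n..<2 * n. h * kernel lam \<alpha> h (int m))"
    unfolding sum_distrib_left by (intro sum_mono t)
  finally show ?thesis by (simp add: sum_distrib_left)
qed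

section \<open>Monotonicity of the window and comparison of \<open>S1h\<close> with
  \<open>S1\<close>\<close>

lemma window_antimono:
  assumes win: "window_function \<gamma> L w"
    and bound: "\<And>\<rho>. 0 < \<rho> \<Longrightarrow> \<rho> < L \<Longrightarrow> 0 \<le> w \<rho>"
    and deriv: "\<And>\<rho>. 0 < \<rho> \<Longrightarrow> \<rho> < L \<Longrightarrow> \<exists>D<0. (w has_real_derivative D) (at \<rho>)"
    and xy: "0 < x" "x \<le> y"
  shows "w y \<le> w x"
proof (cases "y < L")
  case True
  show ?thesis
  proof (cases "x = y")
    case False
    then have "x < y" using xy by simp
    then have "w y < w x"
    proof (rule DERIV_neg_imp_decreasing)
      fix t assume "x \<le> t" "t \<le> y"
      then show "\<exists>D. (w has_real_derivative D) (at t) \<and> D < 0"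
        using deriv[of t] xy True by auto
    qed
    then show ?thesis by simp
  qed simp
next
  case False
  then have "w y = 0" using win by (simp add: window_function_def)
  then show ?thesis using bound[of x] win xy
    by (cases "x < L") (auto simp: window_function_def)
qed

text \<open>The bound \<alpha> \<ge> 1 makes the integrand decreasing, \<alpha> < 2 makes its
  singularity at 0 integrable, and \<open>L = real n * h\<close> lets the cells fill [0, L] exactly.
  Evenness reduces both sides to the positive half line.\<close>

lemma S1h_le_S1:
  assumes "lam \<ge> 0" "1 \<le> \<alpha>" "\<alpha> < 2" "h > 0" "L = real n * h"
    and win: "window_function \<gamma> L w"
    and bound: "\<And>\<rho>. 0 < \<rho> \<Longrightarrow> \<rho> < L \<Longrightarrow> 0 \<le> w \<rho> \<and> w \<rho> \<le> 1"
    and anti: "\<And>x y. 0 < x \<Longrightarrow> x \<le> y \<Longrightarrow> w y \<le> w x"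
  shows "S1h lam \<alpha> w h \<le> S1 lam \<alpha> w L h"
proof -
  define g where "g = (\<lambda>y::real. w \<bar>y\<bar> / (exp (lam * \<bar>y\<bar>) * \<bar>y\<bar> powr (\<alpha> - 1)))"
  have "L \<ge> 0" using assms by simp
  have w0: "w \<rho> = 0" if "\<rho> \<ge> L" for \<rho> using win that by (simp add: window_function_def)
  have wb: "0 \<le> w \<rho> \<and> w \<rho> \<le> 1" if "\<rho> > 0" for \<rho>
    using bound[of \<rho>] w0[of \<rho>] that by (cases "\<rho> < L") auto
  have wcont: "continuous_on {0..} w"
    using win unfolding window_function_def C_k_on_def by (metis le0)
  have ganti: "g y \<le> g x" if "0 < x" "x \<le> y" for x y
  proof -
    have "exp (lam * x) * x powr (\<alpha> - 1) \<le> exp (lam * y) * y powr (\<alpha> - 1)"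
      using that assms by (intro mult_mono powr_mono2) (auto intro: mult_left_mono)
    then show ?thesis
      unfolding g_def using that wb[of x] wb[of y] anti[of x y]
      by (auto intro!: frac_le)
  qed
  have gint: "g integrable_on {0..L}"
  proof -
    \<comment> \<open>Continuity may fail at 0, so integrability comes from measurability on the
      open interval and the majorant \<open>x powr (1 - \<alpha>)\<close>.\<close>
    have "continuous_on {0<..<L} g"
      unfolding g_def
      by (intro continuous_intros continuous_on_compose2[OF wcont]) auto
    then have m: "g \<in> borel_measurable (lebesgue_on {0<..<L})"
      by (intro continuous_imp_measurable_on_sets_lebesgue) auto
    have "(\<lambda>x. x powr (1 - \<alpha>)) integrable_on {0..L}"
      using assms \<open>L \<ge> 0\<close> by (intro integrable_on_powr_from_0) auto
    then have p: "(\<lambda>x. x powr (1 - \<alpha>)) integrable_on {0<..<L}"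
      by (simp add: integrable_on_open_interval_real)
    have "g integrable_on {0<..<L}"
    proof (rule measurable_bounded_by_integrable_imp_integrable[OF m p])
      fix x assume x: "x \<in> {0<..<L}"
      then have "w x / (exp (lam * x) * x powr (\<alpha> - 1)) \<le> 1 / (1 * x powr (\<alpha> - 1))"
        using wb[of x] assms by (intro frac_le mult_right_mono) auto
      then show "norm (g x) \<le> x powr (1 - \<alpha>)"
        using x wb[of x] powr_minus_divide[of x "\<alpha> - 1"] by (simp add: g_def)
    qed auto
    then show ?thesis by (simp add: integrable_on_open_interval_real)
  qed
  have ev: "g (- x) = g x" for x by (simp add: g_def)
  have gint': "g integrable_on {- L..0}" and "integral {- L..0} g = integral {0..L} g"
    using gint Henstock_Kurzweil_Integration.integrable_reflect_real[where a=0 and b=L and f=g]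
      Henstock_Kurzweil_Integration.integral_reflect_real[where a=0 and b=L and f=g]
    by (simp_all add: ev)
  then have I: "integral {- L..L} g = 2 * integral {0..L} g"
  proof -
    have "g integrable_on {- L..L}"
      using gint gint' \<open>L \<ge> 0\<close> by (intro Henstock_Kurzweil_Integration.integrable_combine[where a = "- L" and c = 0 and b = L]) auto
    from Henstock_Kurzweil_Integration.integral_combine[OF _ _ this, where c = 0] show ?thesis
      using \<open>L \<ge> 0\<close> \<open>integral {- L..0} g = _\<close> by simp
  qed
  \<comment> \<open>The window vanishes from \<open>L\<close> on, so only the shifts up to
    \<open>n\<close> in absolute value contribute to the infinite sum.\<close>
  have g0: "g (of_int j * h) = 0" if "\<bar>j\<bar> > int n" for j
  proof -
    have "L \<le> \<bar>of_int j * h\<bar>"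
      using that assms by (auto simp: abs_mult intro!: mult_right_mono)
    then show ?thesis by (simp add: g_def w0)
  qed
  have "(\<Sum>\<^sub>\<infinity>j\<in>UNIV - {0::int}. g (of_int j * h))
      = (\<Sum>\<^sub>\<infinity>j\<in>int ` {1..n} \<union> (\<lambda>j. - int j) ` {1..n}. g (of_int j * h))"
  proof (rule infsum_cong_neutral)
    fix j assume "j \<in> UNIV - {0} - (int ` {1..n} \<union> (\<lambda>j. - int j) ` {1..n})"
    then have "\<bar>j\<bar> > int n"
      by (cases j rule: int_cases2) (auto simp: image_iff)
    then show "g (of_int j * h) = 0" by (rule g0)
  qed auto
  also have "\<dots> = (\<Sum>j\<in>int ` {1..n} \<union> (\<lambda>j. - int j) ` {1..n}. g (of_int j * h))"
    by simp
  also have "\<dots> = 2 * (\<Sum>j=1..n. g (real j * h))"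
    by (subst sum.union_disjoint) (auto simp: sum.reindex inj_on_def ev)
  finally have S: "S1h lam \<alpha> w h = (\<Sum>j=1..n. g (real j * h))"
    by (simp add: S1h_def g_def)
  have "h * (\<Sum>j=1..n. g (real j * h)) \<le> integral {0..L} g"
    using sum_le_integral_antimono[of h n g] ganti gint assms by simp
  moreover have "S1 lam \<alpha> w L h = integral {0..L} g / h"
    using I by (simp add: S1_def g_def)
  ultimately show ?thesis
    using S \<open>h > 0\<close> by (simp add: pos_le_divide_eq mult.commute)
qed

section \<open>Bounds for symmetric diagonally dominant systems\<close>

lemma mult_sqrt_le_sqrt:
  assumes "0 \<le> u" "0 \<le> v" "c * u \<le> sqrt u * sqrt v"
  shows "c * sqrt u \<le> sqrt v"
proof (cases "u = 0")
  case False
  then have "sqrt u > 0" using assms by simp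
  moreover have "sqrt u * (c * sqrt u) = c * u"
    using assms(1) by (simp add: mult.left_commute)
  ultimately show ?thesis
    using assms(3) by (metis mult_le_cancel_left_pos)
qed (use assms in simp)

text \<open>The matrix is \<open>d\<close> times the identity minus \<open>a\<close>. The triangle
  inequality (\<open>row\<close>) reduces the vector equation to a scalar inequality between norms,
  from which both bounds follow for values in any real normed space.\<close>

lemma diag_dominant_bounds:
  fixes a :: "'i \<Rightarrow> 'i \<Rightarrow> real" and u f :: "'i \<Rightarrow> 'a::real_normed_vector"
  assumes "finite I" "c > 0"
    and nn: "\<And>i j. i \<in> I \<Longrightarrow> j \<in> I \<Longrightarrow> a i j \<ge> 0"
    and sym: "\<And>i j. i \<in> I \<Longrightarrow> j \<in> I \<Longrightarrow> a i j = a j i"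
    and dom: "\<And>i. i \<in> I \<Longrightarrow> c + (\<Sum>j\<in>I. a i j) \<le> d"
    and eq: "\<And>i. i \<in> I \<Longrightarrow> f i = d *\<^sub>R u i - (\<Sum>j\<in>I. a i j *\<^sub>R u j)"
  shows "c * sqrt (\<Sum>i\<in>I. (norm (u i))\<^sup>2) \<le> sqrt (\<Sum>i\<in>I. (norm (f i))\<^sup>2)"
    and "I \<noteq> {} \<Longrightarrow> c * Max ((\<lambda>i. norm (u i)) ` I) \<le> Max ((\<lambda>i. norm (f i)) ` I)"
proof -
  have row: "d * norm (u i) - (\<Sum>j\<in>I. a i j * norm (u j)) \<le> norm (f i)" if "i \<in> I" for i
  proof -
    have "d \<ge> 0"
      using dom[OF that] nn that \<open>c > 0\<close> sum_nonneg[of I "a i"] by fastforce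
    have "norm (\<Sum>j\<in>I. a i j *\<^sub>R u j) \<le> (\<Sum>j\<in>I. a i j * norm (u j))"
      using nn that by (intro sum_norm_le) auto
    then show ?thesis
      using norm_triangle_ineq2[of "d *\<^sub>R u i" "\<Sum>j\<in>I. a i j *\<^sub>R u j"] eq[OF that] \<open>d \<ge> 0\<close>
      by simp
  qed
  show "c * Max ((\<lambda>i. norm (u i)) ` I) \<le> Max ((\<lambda>i. norm (f i)) ` I)" if "I \<noteq> {}"
  proof -
    let ?M = "Max ((\<lambda>i. norm (u i)) ` I)"
    have "?M \<in> (\<lambda>i. norm (u i)) ` I" using that \<open>finite I\<close> by (intro Max_in) auto
    then obtain i where i: "i \<in> I" "?M = norm (u i)" by auto
    have "(\<Sum>j\<in>I. a i j * norm (u j)) \<le> (\<Sum>j\<in>I. a i j * ?M)"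
      using \<open>finite I\<close> i(1) nn by (intro sum_mono mult_left_mono Max_ge) auto
    then have "d * ?M - (\<Sum>j\<in>I. a i j) * ?M \<le> norm (f i)"
      using row[OF i(1)] i(2) by (simp add: sum_distrib_right)
    moreover have "(c + (\<Sum>j\<in>I. a i j)) * ?M \<le> d * ?M"
      using dom[OF i(1)] i(2) by (intro mult_right_mono) auto
    moreover have "norm (f i) \<le> Max ((\<lambda>i. norm (f i)) ` I)" using \<open>finite I\<close> i by auto
    ultimately show ?thesis by (simp add: distrib_right)
  qed
  let ?u = "\<Sum>i\<in>I. (norm (u i))\<^sup>2" and ?f = "\<Sum>i\<in>I. (norm (f i))\<^sup>2"
  \<comment> \<open>Symmetry enters here: squares at the column index move to the row index, where
    \<open>dom\<close> controls their weight. They arise below from splitting the mixed products by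
    the arithmetic-geometric mean inequality.\<close>
  have swap: "(\<Sum>i\<in>I. \<Sum>j\<in>I. a i j * (norm (u j))\<^sup>2) = (\<Sum>i\<in>I. \<Sum>j\<in>I. a i j * (norm (u i))\<^sup>2)"
    by (subst sum.swap) (auto intro!: sum.cong simp: sym)
  have "(\<Sum>i\<in>I. \<Sum>j\<in>I. a i j * (norm (u i) * norm (u j)))
      \<le> (\<Sum>i\<in>I. \<Sum>j\<in>I. a i j * (((norm (u i))\<^sup>2 + (norm (u j))\<^sup>2) / 2))"
  proof (intro sum_mono mult_left_mono)
    fix i j
    show "norm (u i) * norm (u j) \<le> ((norm (u i))\<^sup>2 + (norm (u j))\<^sup>2) / 2"
      using sum_squares_bound[of "norm (u i)" "norm (u j)"] by simp
  qed (use nn in auto)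
  also have "\<dots> = (\<Sum>i\<in>I. \<Sum>j\<in>I. a i j * (norm (u i))\<^sup>2)"
    using swap by (simp add: distrib_left sum.distrib add_divide_distrib sum_divide_distrib[symmetric])
  finally have off: "(\<Sum>i\<in>I. \<Sum>j\<in>I. a i j * (norm (u i) * norm (u j)))
      \<le> (\<Sum>i\<in>I. \<Sum>j\<in>I. a i j * (norm (u i))\<^sup>2)" .
  have "c * ?u = (\<Sum>i\<in>I. c * (norm (u i))\<^sup>2)"
    by (rule sum_distrib_left)
  also have "\<dots> \<le> (\<Sum>i\<in>I. (d - (\<Sum>j\<in>I. a i j)) * (norm (u i))\<^sup>2)"
    using dom by (intro sum_mono mult_right_mono) (auto simp: algebra_simps)
  also have "\<dots> = (\<Sum>i\<in>I. d * (norm (u i))\<^sup>2) - (\<Sum>i\<in>I. \<Sum>j\<in>I. a i j * (norm (u i))\<^sup>2)"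
    by (simp add: left_diff_distrib sum_subtractf sum_distrib_right)
  also have "\<dots> \<le> (\<Sum>i\<in>I. d * (norm (u i))\<^sup>2)
      - (\<Sum>i\<in>I. \<Sum>j\<in>I. a i j * (norm (u i) * norm (u j)))"
    using off by simp
  also have "\<dots> = (\<Sum>i\<in>I. norm (u i) * (d * norm (u i) - (\<Sum>j\<in>I. a i j * norm (u j))))"
    by (simp add: right_diff_distrib sum_subtractf sum_distrib_left power2_eq_square mult_ac)
  also have "\<dots> \<le> (\<Sum>i\<in>I. norm (u i) * norm (f i))"
    using row by (intro sum_mono mult_left_mono) auto
  also have "\<dots> \<le> sqrt ?u * sqrt ?f"
    using L2_set_mult_ineq[of "\<lambda>i. norm (u i)" "\<lambda>i. norm (f i)" I] by (simp add: L2_set_def)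
  finally have le: "c * ?u \<le> sqrt ?u * sqrt ?f" .
  show "c * sqrt ?u \<le> sqrt ?f"
    by (rule mult_sqrt_le_sqrt[OF _ _ le]) (intro sum_nonneg zero_le_power2)+
qed

section \<open>The scheme as a finite linear system\<close>

lemma inj_node: "h > 0 \<Longrightarrow> inj (node h)"
  by (auto simp: inj_def node_def)

text \<open>Since \<open>U\<close> vanishes off the grid, only shifts landing on the grid survive.
  \<open>B\<close> is the Laplacian coefficient with its sign reversed: it adds \<open>2 * B\<close>
  to the diagonal and couples each node to its neighbours with weight \<open>B\<close>.\<close>

lemma WIRFD_node:
  fixes U :: "real \<Rightarrow> 'a::real_normed_vector" and N :: nat and lam \<alpha> h L :: real
    and w :: "real \<Rightarrow> real"
  assumes "h > 0" and i: "i \<in> {1..int N}"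
    and zero: "\<And>j. j \<notin> {1..int N} \<Longrightarrow> U (node h j) = 0"
  defines "B \<equiv> (S1 lam \<alpha> w L h - S1h lam \<alpha> w h) / h\<^sup>2"
  shows "WIRFD lam \<alpha> w L h U (node h i) =
    (C_const lam \<alpha> * h * (2 * B + S2 lam \<alpha> h)) *\<^sub>R U (node h i)
    - (\<Sum>j\<in>{1..int N}. (C_const lam \<alpha> * h *
        (kernel lam \<alpha> h (j - i) + (if \<bar>j - i\<bar> = 1 then B else 0))) *\<^sub>R U (node h j))"
proof -
  let ?I = "{1..int N}" and ?k = "kernel lam \<alpha> h"
  define v where "v j = U (node h j)" for j
  have shift: "U (node h i + of_int j * h) = v (j + i)" for j
    by (simp add: v_def node_def algebra_simps)
  have v: "U (node h i) = v i" "U (node h i - h) = v (i - 1)" "U (node h i + h) = v (i + 1)"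
    by (simp_all add: v_def node_def algebra_simps)
  \<comment> \<open>Division by zero gives the kernel the value 0 at shift 0, so the index
    \<open>j = i\<close> may stay in the finite sum.\<close>
  have k0: "?k 0 = 0" by (simp add: kernel_def)
  have "(\<Sum>\<^sub>\<infinity>j\<in>UNIV - {0}. ?k j *\<^sub>R U (node h i + of_int j * h))
      = (\<Sum>\<^sub>\<infinity>j\<in>(\<lambda>j. j - i) ` ?I. ?k j *\<^sub>R v (j + i))"
    unfolding shift
  proof (rule infsum_cong_neutral)
    fix j assume "j \<in> UNIV - {0} - (\<lambda>j. j - i) ` ?I"
    then have "j + i \<notin> ?I" by (auto simp: image_iff)
    then show "?k j *\<^sub>R v (j + i) = 0" by (simp add: v_def zero)
  qed (auto simp: k0)
  also have "\<dots> = (\<Sum>j\<in>(\<lambda>j. j - i) ` ?I. ?k j *\<^sub>R v (j + i))"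
    by (rule infsum_finite) simp
  also have "\<dots> = (\<Sum>j\<in>?I. ?k (j - i) *\<^sub>R v j)"
    by (subst sum.reindex) (auto simp: inj_on_def)
  finally have conv: "(\<Sum>\<^sub>\<infinity>j\<in>UNIV - {0}. ?k j *\<^sub>R U (node h i + of_int j * h))
      = (\<Sum>j\<in>?I. ?k (j - i) *\<^sub>R v j)" .
  \<comment> \<open>A neighbour may fall off the grid, but \<open>v\<close> is 0 there, so both
    neighbours can always be counted.\<close>
  have "(\<Sum>j\<in>?I. (if \<bar>j - i\<bar> = 1 then B else 0) *\<^sub>R v j)
      = (\<Sum>j\<in>{i - 1, i + 1}. B *\<^sub>R v j)"
    by (rule sum.mono_neutral_cong) (auto simp: v_def zero)
  then have nb: "(\<Sum>j\<in>?I. (if \<bar>j - i\<bar> = 1 then B else 0) *\<^sub>R v j) = B *\<^sub>R (v (i - 1) + v (i + 1))"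
    by (simp add: scaleR_add_right)
  have lap: "(S1h lam \<alpha> w h - S1 lam \<alpha> w L h) *\<^sub>R discrete_laplacian h U (node h i)
      = (2 * B) *\<^sub>R v i - B *\<^sub>R (v (i - 1) + v (i + 1))"
  proof -
    have "(S1h lam \<alpha> w h - S1 lam \<alpha> w L h) * (1 / h\<^sup>2) = - B"
      by (simp add: B_def diff_divide_distrib)
    then have "(S1h lam \<alpha> w h - S1 lam \<alpha> w L h) *\<^sub>R discrete_laplacian h U (node h i)
      = (- B) *\<^sub>R (v (i - 1) - 2 *\<^sub>R v i + v (i + 1))"
      unfolding discrete_laplacian_def v scaleR_scaleR by simp
    then show ?thesis by (simp add: algebra_simps)
  qed
  have "WIRFD lam \<alpha> w L h U (node h i) = (C_const lam \<alpha> * h) *\<^sub>R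
      ((2 * B + S2 lam \<alpha> h) *\<^sub>R v i
       - (\<Sum>j\<in>?I. (?k (j - i) + (if \<bar>j - i\<bar> = 1 then B else 0)) *\<^sub>R v j))"
    unfolding WIRFD_def kernel_def[symmetric] conv lap
    by (simp add: scaleR_add_left sum.distrib nb v algebra_simps)
  then show ?thesis
    by (simp add: v_def scaleR_diff_right scaleR_sum_right)
qed

text \<open>The class of \<open>'a\<close> admits real and complex values. With \<open>f = 0\<close>
  the bounds force \<open>U\<close> to vanish on the grid, so the square system determines its
  solution uniquely.\<close>

theorem theorem4p3:
  fixes lam \<alpha> h L L\<^sub>\<Omega> c\<^sub>0 :: real
    and N\<^sub>1 N N\<^sub>\<rho> \<gamma> :: nat
    and w :: "real \<Rightarrow> real"
    and f U :: "real \<Rightarrow> 'a :: {real_normed_field, real_inner}"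
  assumes "lam \<ge> 0" and "1 \<le> \<alpha>" and "\<alpha> < 2"
    and "N\<^sub>1 \<ge> 2" and "h = 2 / real N\<^sub>1" and "N = N\<^sub>1 - 1"
    and "N\<^sub>\<rho> > 0" and "L = real N\<^sub>\<rho> * h"
    and "window_function \<gamma> L w"
    and "\<And>\<rho>. 0 < \<rho> \<Longrightarrow> \<rho> < L \<Longrightarrow> 0 \<le> w \<rho> \<and> w \<rho> \<le> 1"
    and "\<And>\<rho>. 0 < \<rho> \<Longrightarrow> \<rho> < L \<Longrightarrow> \<exists>D<0. (w has_real_derivative D) (at \<rho>)"
    and "\<And>x. x \<in> grid N h \<Longrightarrow> WIRFD lam \<alpha> w L h U x = f x"
    and "\<And>x. x \<in> lattice h - grid N h \<Longrightarrow> U x = 0"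
    and "L\<^sub>\<Omega> = (real N + 1) * h"
    and "c\<^sub>0 = 2 * C_const lam \<alpha> * (1 - 2 powr (- \<alpha>)) / (\<alpha> * exp (2 * lam * L\<^sub>\<Omega>) * L\<^sub>\<Omega> powr \<alpha>)"
  shows "c\<^sub>0 > 0
    \<and> l2_norm N h U \<le> 1 / c\<^sub>0 * l2_norm N h f
    \<and> linf_norm N h U \<le> 1 / c\<^sub>0 * linf_norm N h f"
proof -
  let ?I = "{1..int N}" and ?k = "kernel lam \<alpha> h"
  define C where "C = C_const lam \<alpha>"
  define B where "B = (S1 lam \<alpha> w L h - S1h lam \<alpha> w h) / h\<^sup>2"
  define a where "a i j = C * h * (?k (j - i) + (if \<bar>j - i\<bar> = 1 then B else 0))" for i j :: int
  define d where "d = C * h * (2 * B + S2 lam \<alpha> h)"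
  have h: "h > 0" and N: "N \<ge> 1" using assms by auto
  have L: "L\<^sub>\<Omega> > 0" using h assms(14) by simp
  have C: "C > 0" unfolding C_def using assms(2,3) by (intro C_const_pos)
  have "(2::real) powr (- \<alpha>) < 2 powr 0" using assms(2) by (intro powr_less_mono) auto
  then have c0: "c\<^sub>0 > 0" using C L assms(2,15) by (simp add: C_def)
  have w: "w y \<le> w x" if "0 < x" "x \<le> y" for x y
    by (rule window_antimono[OF assms(9)]) (use assms(10,11) that in auto)
  \<comment> \<open>This sign makes the couplings between neighbours nonnegative in
    \<open>a\<close>.\<close>
  have B: "B \<ge> 0"
    using S1h_le_S1[OF assms(1-3) h assms(8-10) w] by (simp add: B_def)
  have dom: "c\<^sub>0 + (\<Sum>j\<in>?I. a i j) \<le> d" if i: "i \<in> ?I" for i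
  proof -
    \<comment> \<open>\<open>K\<close> holds the nonzero shifts from \<open>i\<close> that stay on
      the grid. \<open>J\<close> and \<open>J'\<close> leave it from every node, whatever
      \<open>i\<close> is. Starting them at \<open>N + 1\<close> makes \<open>R\<close> in the tail
      estimate equal to \<open>L\<^sub>\<Omega>\<close>, and having both sides yields the factor 2
      in \<open>c\<^sub>0\<close>.\<close>
    define J where "J = int ` {N + 1..<2 * (N + 1)}"
    define J' where "J' = (\<lambda>m. - int m) ` {N + 1..<2 * (N + 1)}"
    define K where "K = (\<lambda>j. j - i) ` (?I - {i})"
    define T where "T = (\<Sum>m=N + 1..<2 * (N + 1). ?k (int m))"
    have k0: "?k 0 = 0" by (simp add: kernel_def)
    have fin: "finite J" "finite J'" "finite K" by (simp_all add: J_def J'_def K_def)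
    have J: "x > int N" if "x \<in> J" for x using that by (auto simp: J_def)
    have J': "x < - int N" if "x \<in> J'" for x using that by (auto simp: J'_def)
    have K: "x \<noteq> 0 \<and> \<bar>x\<bar> < int N" if "x \<in> K" for x using that i by (auto simp: K_def)
    have "K \<union> (J \<union> J') \<subseteq> UNIV - {0}" using J J' K by force
    moreover have "?k summable_on UNIV - {0}"
      using assms(1,2) h by (intro kernel_summable) auto
    ultimately have "sum ?k (K \<union> (J \<union> J')) \<le> S2 lam \<alpha> h"
      unfolding S2_def kernel_def[symmetric] using fin
      by (intro finite_sum_le_infsum kernel_nonneg finite_UnI)
    also have "sum ?k (K \<union> (J \<union> J')) = sum ?k K + (sum ?k J + sum ?k J')"
    proof -
      have "K \<inter> (J \<union> J') = {}" using J J' K by force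
      moreover have "J \<inter> J' = {}" using J J' by force
      ultimately show ?thesis using fin by (simp add: sum.union_disjoint)
    qed
    also have "sum ?k K = (\<Sum>j\<in>?I - {i}. ?k (j - i))"
      unfolding K_def by (subst sum.reindex) (auto simp: inj_on_def)
    also have "sum ?k J = T"
      unfolding J_def T_def by (subst sum.reindex) auto
    also have "sum ?k J' = T"
      unfolding J'_def T_def by (subst sum.reindex) (auto simp: inj_on_def)
    also have "(\<Sum>j\<in>?I - {i}. ?k (j - i)) = (\<Sum>j\<in>?I. ?k (j - i))"
      by (rule sum.mono_neutral_left) (auto simp: k0)
    finally have s2: "(\<Sum>j\<in>?I. ?k (j - i)) + 2 * T \<le> S2 lam \<alpha> h" by simp
    have "(\<Sum>j\<in>?I. if \<bar>j - i\<bar> = 1 then B else 0) = (\<Sum>j\<in>{j\<in>?I. \<bar>j - i\<bar> = 1}. B)"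
      by (rule sum.inter_filter[symmetric]) simp
    \<comment> \<open>Only an inequality, because the end nodes lack a neighbour on the
      grid.\<close>
    also have "\<dots> \<le> (\<Sum>j\<in>{i - 1, i + 1}. B)"
      using B by (intro sum_mono2) auto
    finally have nb: "(\<Sum>j\<in>?I. if \<bar>j - i\<bar> = 1 then B else 0) \<le> 2 * B" by simp
    have "c\<^sub>0 = 2 * C * ((1 - 2 powr (- \<alpha>)) / (\<alpha> * exp (2 * lam * L\<^sub>\<Omega>) * L\<^sub>\<Omega> powr \<alpha>))"
      using assms(15) by (simp add: C_def)
    also have "\<dots> \<le> 2 * C * (h * T)"
      using sum_kernel_tail_ge[of lam \<alpha> h "N + 1"] assms(1,2,14) h C unfolding T_def
      by (intro mult_left_mono) (auto simp: add.commute)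
    finally have "c\<^sub>0 + (\<Sum>j\<in>?I. a i j) \<le> C * h * (2 * T)
        + C * h * ((\<Sum>j\<in>?I. ?k (j - i)) + (\<Sum>j\<in>?I. if \<bar>j - i\<bar> = 1 then B else 0))"
      by (simp add: a_def sum_distrib_left[symmetric] sum.distrib)
    \<comment> \<open>On the diagonal, \<open>S2\<close> pays for the kernel entries and both tails,
      and \<open>2 * B\<close> pays for the neighbours.\<close>
    also have "\<dots> \<le> d"
      unfolding d_def distrib_left[symmetric] using s2 nb C h by (intro mult_left_mono) auto
    finally show ?thesis .
  qed
  have sym: "a i j = a j i" for i j
    using kernel_minus[of lam \<alpha> h "j - i"] by (simp add: a_def abs_minus_commute)
  have nn: "a i j \<ge> 0" for i j
    using B C h by (simp add: a_def kernel_nonneg)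
  have eq: "f (node h i) = d *\<^sub>R U (node h i) - (\<Sum>j\<in>?I. a i j *\<^sub>R U (node h j))"
    if i: "i \<in> ?I" for i
  proof -
    have "U (node h j) = 0" if "j \<notin> ?I" for j
    proof (rule assms(13))
      \<comment> \<open>Distinct indices give distinct points, so an index outside 1..N names a
        point off the grid.\<close>
      have "node h j \<notin> grid N h"
        using that unfolding grid_def inj_image_mem_iff[OF inj_node[OF h]] .
      then show "node h j \<in> lattice h - grid N h" by (simp add: lattice_def)
    qed
    then show ?thesis
      unfolding a_def d_def C_def B_def assms(12)[OF imageI[OF i, of "node h", folded grid_def], symmetric]
      by (rule WIRFD_node[OF h i])
  qed
  note b = diag_dominant_bounds[of ?I c\<^sub>0 a d "\<lambda>i. f (node h i)" "\<lambda>i. U (node h i)",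
      OF finite_atLeastAtMost_int c0 nn sym dom eq]
  have l2: "l2_norm N h g = sqrt h * sqrt (\<Sum>i\<in>?I. (norm (g (node h i)))\<^sup>2)" for g :: "real \<Rightarrow> 'a"
    using inj_on_subset[OF inj_node[OF h], of ?I]
    by (simp add: l2_norm_def grid_def sum.reindex real_sqrt_mult)
  have linf: "linf_norm N h g = Max ((\<lambda>i. norm (g (node h i))) ` ?I)" for g :: "real \<Rightarrow> 'a"
    by (simp add: linf_norm_def grid_def image_image)
  have l2_le: "c\<^sub>0 * l2_norm N h U \<le> l2_norm N h f"
    using mult_left_mono[OF b(1), of "sqrt h"] h by (simp add: l2 mult_ac)
  have linf_le: "c\<^sub>0 * linf_norm N h U \<le> linf_norm N h f"
    unfolding linf
  proof (rule b(2))
    have "1 \<in> ?I" using N by auto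
    then show "?I \<noteq> {}" by blast
  qed
  have scale: "x \<le> 1 / c\<^sub>0 * y" if "c\<^sub>0 * x \<le> y" for x y
    using that pos_le_divide_eq[OF c0, of x y] by (simp only: mult.commute[of x] times_divide_eq_left mult_1)
  show ?thesis
    by (rule conjI[OF c0 conjI[OF scale[OF l2_le] scale[OF linf_le]]])
qed

end
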